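(* Let $\mathcal A\subset\mathbb R^d$ be a symmetric set ($\mathcal A=-\mathcal A$) of $2n$ atoms with $\|s\|_2=1$ for all $s\in\mathcal A$. Let $\mathcal B$ be a set such that $\mathcal A=\mathcal B\cup-\mathcal B$ with $\mathcal B\cap-\mathcal B=\emptyset$ and $|\mathcal B|=n$. Then the cumulative coherence of $\mathcal B$ satisfies $$\mu(\mathcal B,n-1)\ge1-n\cdot\operatorname{mDW}(\mathcal A)^2 .$$
   Context: For $m<n$, the cumulative coherence of $\mathcal B$ is $$\mu(\mathcal B,m):=\max_{\mathcal I\subset\mathcal B,\ |\mathcal I|=m}\ \max_{s_i\in\mathcal B\setminus\mathcal I}\ \sum_{s_j\in\mathcal I}|\langle s_i,s_j\rangle| .$$ The minimal intrinsic directional width of $\mathcal A$ is $$\operatorname{mDW}(\mathcal A):=\min_{d\in\operatorname{lin}(\mathcal A),\ d\neq0}\ \max_{z\in\mathcal A}\Big\langle\frac{d}{\|d\|_2},z\Big\rangle,$$ where $\operatorname{lin}(\mathcal A)$ is the linear span of $\mathcal A$. *)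

theory Defs
  imports "HOL-Analysis.Analysis"
begin

text \<open>Both maxima range over finite nonempty sets when \<^term>\<open>B\<close> is finite and
  \<^term>\<open>m < card B\<close>, which is the only intended use.\<close>

definition cumulative_coherence :: "'a::real_inner set \<Rightarrow> nat \<Rightarrow> real" where
  "cumulative_coherence B m =
     (MAX I \<in> {I. I \<subseteq> B \<and> card I = m}. MAX s \<in> B - I. \<Sum>t\<in>I. \<bar>s \<bullet> t\<bar>)"

definition directional_width :: "'a::real_inner set \<Rightarrow> 'a \<Rightarrow> real" where
  "directional_width A d = (MAX z \<in> A. (d /\<^sub>R norm d) \<bullet> z)"

text \<open>The minimum over the (infinite) set of nonzero directions is written as an infimum;
  \<open>mDW_attained\<close> below shows that it is a minimum for finite atom sets.\<close>

definition mDW :: "'a::real_inner set \<Rightarrow> real" where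
  "mDW A = (INF d \<in> span A - {0}. directional_width A d)"

lemma continuous_on_MAX:
  fixes f :: "'b \<Rightarrow> 'a::topological_space \<Rightarrow> real"
  assumes "finite A" "A \<noteq> {}" "\<And>z. z \<in> A \<Longrightarrow> continuous_on S (f z)"
  shows "continuous_on S (\<lambda>x. MAX z \<in> A. f z x)"
  using assms
proof (induction A rule: finite_ne_induct)
  case (singleton z)
  then show ?case by simp
next
  case (insert z A)
  have "continuous_on S (\<lambda>x. max (f z x) (MAX z \<in> A. f z x))"
    using insert by (intro continuous_on_max) auto
  then show ?case using insert by simp
qed

lemma mDW_attained:
  fixes A :: "'a::euclidean_space set"
  assumes "finite A" and "\<not> A \<subseteq> {0}"
  shows "\<exists>d \<in> span A - {0}. mDW A = directional_width A d \<and>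
           (\<forall>e \<in> span A - {0}. directional_width A d \<le> directional_width A e)"
proof -
  define K where "K = sphere (0::'a) 1 \<inter> span A"
  have cpt: "compact K"
    unfolding K_def by (intro compact_Int_closed compact_sphere closed_span)
  obtain a where a: "a \<in> A" "a \<noteq> 0" using assms(2) by blast
  have norm_K: "e /\<^sub>R norm e \<in> K" if "e \<in> span A - {0}" for e
    using that by (auto simp: K_def span_scale)
  have ne: "K \<noteq> {}" using norm_K[of a] a by (auto simp: span_base)
  have "continuous_on K (\<lambda>d. MAX z \<in> A. d \<bullet> z)"
    using assms a by (intro continuous_on_MAX continuous_intros) auto
  then obtain d where d: "d \<in> K" "\<forall>e \<in> K. (MAX z \<in> A. d \<bullet> z) \<le> (MAX z \<in> A. e \<bullet> z)"
    using continuous_attains_inf[OF cpt ne] by blast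
  have dS: "d \<in> span A - {0}" using d(1) by (auto simp: K_def)
  have nd: "norm d = 1" using d(1) by (simp add: K_def)
  have le: "directional_width A d \<le> directional_width A e" if "e \<in> span A - {0}" for e
    using bspec[OF d(2) norm_K[OF that]] nd by (simp add: directional_width_def)
  have "mDW A = directional_width A d"
    unfolding mDW_def using dS le by (intro cInf_eq_minimum) auto
  then show ?thesis using dS le by blast
qed

end

theory Submission
  imports Defs
begin

text \<open>Put \<open>\<lambda> = 1 - \<mu>(B, n - 1)\<close>. By Gershgorin's argument the Gram matrix of \<open>B\<close> satisfies
  \<open>\<parallel>d\<parallel>\<^sup>2 \<ge> \<lambda> \<Sum> x\<^sub>s\<^sup>2\<close> for \<open>d = \<Sum> x\<^sub>s s\<close>. Cauchy-Schwarz applied to \<open>\<parallel>d\<parallel>\<^sup>2 = \<Sum> x\<^sub>s \<langle>s, d\<rangle>\<close> then gives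
  \<open>\<lambda> \<parallel>d\<parallel>\<^sup>2 \<le> \<Sum> \<langle>s, d\<rangle>\<^sup>2\<close>, and each of the \<open>n\<close> terms on the right is at most the squared width
  of \<open>A\<close> in direction \<open>d\<close>, times \<open>\<parallel>d\<parallel>\<^sup>2\<close>.\<close>

text \<open>The set \<open>B - {s}\<close> competes in the outer maximum, and \<open>s\<close> is
  the only element left for the inner one. These sums are the absolute off-diagonal row sums of the
  Gram matrix.\<close>

lemma sum_abs_inner_le_cumulative_coherence:
  assumes "finite B" "s \<in> B"
  shows "(\<Sum>t\<in>B - {s}. \<bar>s \<bullet> t\<bar>) \<le> cumulative_coherence B (card B - 1)"
proof -
  have "B - (B - {s}) = {s}" using assms by auto
  then have "(\<Sum>t\<in>B - {s}. \<bar>s \<bullet> t\<bar>) = (MAX u \<in> B - (B - {s}). \<Sum>t\<in>B - {s}. \<bar>u \<bullet> t\<bar>)"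
    by simp
  also have "\<dots> \<le> cumulative_coherence B (card B - 1)"
    unfolding cumulative_coherence_def using assms
    by (intro Max_ge finite_imageI imageI finite_Collect_conjI) (auto simp: card_Diff_singleton)
  finally show ?thesis .
qed

text \<open>Expanding the squared norm, the diagonal contributes the sum of squares. Each
  off-diagonal term loses at most the average of its two squared coefficients times the absolute
  inner product, and symmetry gathers these losses into row sums.\<close>

lemma gershgorin_norm_sum_scaleR:
  fixes B :: "'a::real_inner set"
  assumes fin: "finite B" and unit: "\<And>s. s \<in> B \<Longrightarrow> norm s = 1"
    and row: "\<And>s. s \<in> B \<Longrightarrow> (\<Sum>t\<in>B - {s}. \<bar>s \<bullet> t\<bar>) \<le> m"
  shows "(1 - m) * (\<Sum>s\<in>B. (x s)\<^sup>2) \<le> (norm (\<Sum>s\<in>B. x s *\<^sub>R s))\<^sup>2"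
proof -
  define r where "r s = (\<Sum>t\<in>B - {s}. \<bar>s \<bullet> t\<bar>)" for s
  \<comment> \<open>Symmetry of the Gram matrix moves the weight from the column index to the row
    index.\<close>
  have swap: "(\<Sum>s\<in>B. \<Sum>t\<in>B - {s}. (x t)\<^sup>2 * \<bar>s \<bullet> t\<bar>) = (\<Sum>s\<in>B. \<Sum>t\<in>B - {s}. (x s)\<^sup>2 * \<bar>s \<bullet> t\<bar>)"
  proof -
    have "(\<Sum>s\<in>B. \<Sum>t\<in>B - {s}. (x t)\<^sup>2 * \<bar>s \<bullet> t\<bar>)
        = (\<Sum>s\<in>B. \<Sum>t | t \<in> B \<and> t \<noteq> s. (x t)\<^sup>2 * \<bar>s \<bullet> t\<bar>)"
      by (intro sum.cong) auto
    also have "\<dots> = (\<Sum>t\<in>B. \<Sum>s | s \<in> B \<and> t \<noteq> s. (x t)\<^sup>2 * \<bar>s \<bullet> t\<bar>)"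
      by (rule sum.swap_restrict[OF fin fin])
    also have "\<dots> = (\<Sum>s\<in>B. \<Sum>t\<in>B - {s}. (x s)\<^sup>2 * \<bar>s \<bullet> t\<bar>)"
      by (intro sum.cong) (auto simp: inner_commute)
    finally show ?thesis .
  qed
  have amgm: "- (((x s)\<^sup>2 * c + (x t)\<^sup>2 * c) / 2) \<le> x s * x t * g" if "c = \<bar>g\<bar>" for s t c g
  proof -
    have "2 * (\<bar>x s\<bar> * \<bar>x t\<bar>) \<le> (x s)\<^sup>2 + (x t)\<^sup>2"
      using sum_squares_bound[of "\<bar>x s\<bar>" "\<bar>x t\<bar>"] by simp
    then have "2 * (\<bar>x s\<bar> * \<bar>x t\<bar>) * \<bar>g\<bar> \<le> ((x s)\<^sup>2 + (x t)\<^sup>2) * \<bar>g\<bar>"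
      by (intro mult_right_mono) auto
    moreover have "- (\<bar>x s\<bar> * \<bar>x t\<bar> * \<bar>g\<bar>) \<le> x s * x t * g"
      by (metis abs_ge_minus_self abs_mult minus_le_iff)
    ultimately have "- (((x s)\<^sup>2 + (x t)\<^sup>2) * \<bar>g\<bar> / 2) \<le> x s * x t * g" by linarith
    then show ?thesis by (simp add: that distrib_right)
  qed
  have "(1 - m) * (\<Sum>s\<in>B. (x s)\<^sup>2) \<le> (\<Sum>s\<in>B. (x s)\<^sup>2 - (x s)\<^sup>2 * r s)"
    unfolding sum_distrib_left
  proof (rule sum_mono)
    fix s assume "s \<in> B"
    then have "(x s)\<^sup>2 * r s \<le> (x s)\<^sup>2 * m"
      using row by (intro mult_left_mono) (auto simp: r_def)
    then show "(1 - m) * (x s)\<^sup>2 \<le> (x s)\<^sup>2 - (x s)\<^sup>2 * r s" by (simp add: algebra_simps)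
  qed
  also have "\<dots> = (\<Sum>s\<in>B. (x s)\<^sup>2) - (\<Sum>s\<in>B. \<Sum>t\<in>B - {s}. (x s)\<^sup>2 * \<bar>s \<bullet> t\<bar>)"
    by (simp add: sum_subtractf r_def sum_distrib_left)
  \<comment> \<open>By \<open>swap\<close> both halves of the average have the same total; this form
    can be bounded termwise by \<open>amgm\<close>.\<close>
  also have "\<dots> = (\<Sum>s\<in>B. (x s)\<^sup>2)
      + (\<Sum>s\<in>B. \<Sum>t\<in>B - {s}. - (((x s)\<^sup>2 * \<bar>s \<bullet> t\<bar> + (x t)\<^sup>2 * \<bar>s \<bullet> t\<bar>) / 2))"
    by (simp add: sum_negf sum.distrib swap flip: sum_divide_distrib)
  also have "\<dots> \<le> (\<Sum>s\<in>B. (x s)\<^sup>2) + (\<Sum>s\<in>B. \<Sum>t\<in>B - {s}. x s * x t * (s \<bullet> t))"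
    by (intro add_left_mono sum_mono amgm) simp
  also have "\<dots> = (\<Sum>s\<in>B. \<Sum>t\<in>B. x s * x t * (s \<bullet> t))"
    unfolding sum.distrib[symmetric]
  proof (rule sum.cong[OF refl])
    fix s assume s: "s \<in> B"
    then have "s \<bullet> s = 1" using unit by (simp add: dot_square_norm)
    then show "(x s)\<^sup>2 + (\<Sum>t\<in>B - {s}. x s * x t * (s \<bullet> t)) = (\<Sum>t\<in>B. x s * x t * (s \<bullet> t))"
      by (simp add: sum.remove[OF fin s] power2_eq_square)
  qed
  also have "\<dots> = (norm (\<Sum>s\<in>B. x s *\<^sub>R s))\<^sup>2"
    unfolding power2_norm_eq_inner inner_sum_left inner_sum_right
    by (intro sum.cong refl) (simp add: ac_simps inner_commute)
  finally show ?thesis .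
qed

lemma lower_frame_bound:
  fixes B :: "'a::real_inner set"
  assumes fin: "finite B" and unit: "\<And>s. s \<in> B \<Longrightarrow> norm s = 1"
    and row: "\<And>s. s \<in> B \<Longrightarrow> (\<Sum>t\<in>B - {s}. \<bar>s \<bullet> t\<bar>) \<le> m"
    and d: "d \<in> span B"
  shows "(1 - m) * (norm d)\<^sup>2 \<le> (\<Sum>s\<in>B. (d \<bullet> s)\<^sup>2)"
\<comment> \<open>In the degenerate case the left side is nonpositive. Otherwise Cauchy-Schwarz may
  be multiplied by \<open>1 - m\<close>, and \<open>norm d\<close> can be cancelled at the
  end.\<close>
proof (cases "1 - m \<le> 0 \<or> d = 0")
  case True
  then have "(1 - m) * (norm d)\<^sup>2 \<le> 0" by (auto simp: mult_nonpos_nonneg)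
  also have "\<dots> \<le> (\<Sum>s\<in>B. (d \<bullet> s)\<^sup>2)" by (simp add: sum_nonneg)
  finally show ?thesis .
next
  case False
  obtain x where x: "d = (\<Sum>s\<in>B. x s *\<^sub>R s)"
    using d span_finite[OF fin] by auto
  \<comment> \<open>Only one of the two copies of \<open>d\<close> is expanded, so that
    Cauchy-Schwarz separates the coefficients from the inner products
    \<open>d \<bullet> s\<close>.\<close>
  have "(norm d)\<^sup>2 = (\<Sum>s\<in>B. x s * (d \<bullet> s))"
  proof -
    have "(norm d)\<^sup>2 = d \<bullet> (\<Sum>s\<in>B. x s *\<^sub>R s)"
      by (simp add: power2_norm_eq_inner flip: x)
    then show ?thesis by (simp add: inner_sum_right)
  qed
  then have "((norm d)\<^sup>2)\<^sup>2 \<le> (\<Sum>s\<in>B. (x s)\<^sup>2) * (\<Sum>s\<in>B. (d \<bullet> s)\<^sup>2)"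
    by (simp add: Cauchy_Schwarz_ineq_sum)
  then have "(1 - m) * ((norm d)\<^sup>2)\<^sup>2 \<le> (1 - m) * ((\<Sum>s\<in>B. (x s)\<^sup>2) * (\<Sum>s\<in>B. (d \<bullet> s)\<^sup>2))"
    using False by (intro mult_left_mono) auto
  also have "\<dots> = (1 - m) * (\<Sum>s\<in>B. (x s)\<^sup>2) * (\<Sum>s\<in>B. (d \<bullet> s)\<^sup>2)"
    by (simp add: mult.assoc)
  \<comment> \<open>Gershgorin's bound eliminates the coefficients and leaves a common factor
    \<open>(norm d)\<^sup>2\<close>.\<close>
  also have "\<dots> \<le> (norm d)\<^sup>2 * (\<Sum>s\<in>B. (d \<bullet> s)\<^sup>2)"
    using gershgorin_norm_sum_scaleR[OF fin unit row, of x]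
    by (intro mult_right_mono sum_nonneg) (auto simp: x)
  finally have "(norm d)\<^sup>2 * ((1 - m) * (norm d)\<^sup>2) \<le> (norm d)\<^sup>2 * (\<Sum>s\<in>B. (d \<bullet> s)\<^sup>2)"
    by (simp add: power2_eq_square ac_simps)
  then show ?thesis using False by simp
qed

text \<open>The maximum bounds inner products from above only; applying it to \<open>- s\<close> too
  gives the bound from below.\<close>

lemma abs_inner_le_directional_width:
  assumes "finite A" "s \<in> A" "- s \<in> A" "d \<noteq> 0"
  shows "\<bar>d \<bullet> s\<bar> \<le> directional_width A d * norm d"
proof -
  have "(d /\<^sub>R norm d) \<bullet> z \<le> directional_width A d" if "z \<in> A" for z
    unfolding directional_width_def using assms(1) that by (intro Max_ge) auto
  then have "d \<bullet> z \<le> directional_width A d * norm d" if "z \<in> A" for z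
    using that assms(4) by (fastforce simp: field_simps)
  from this[OF assms(2)] this[OF assms(3)] show ?thesis by simp
qed

theorem theorem10:
  fixes A B :: "(real ^ 'd) set" and n :: nat
  assumes "n \<ge> 1"
    and "finite A" and "card A = 2 * n"
    and "A = uminus ` A"
    and "\<And>s. s \<in> A \<Longrightarrow> norm s = 1"
    and "A = B \<union> uminus ` B"
    and "B \<inter> uminus ` B = {}"
    and "card B = n"
  shows "cumulative_coherence B (n - 1) \<ge> 1 - real n * (mDW A)\<^sup>2"
proof -
  have BA: "B \<subseteq> A" and finB: "finite B" using assms(2,6) by auto
  have "A \<noteq> {}" using assms(1,3) by auto
  then have "\<not> A \<subseteq> {0}" using assms(5) by fastforce
  then obtain d where d: "d \<in> span A" "d \<noteq> 0" and w: "mDW A = directional_width A d"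
    using mDW_attained[OF assms(2)] by blast
  \<comment> \<open>The minimizing direction lies in the span of \<open>A\<close>, while the frame
    bound needs a combination of \<open>B\<close>; negated atoms do not enlarge the span.\<close>
  have "A \<subseteq> span B" unfolding assms(6) by (auto intro: span_base span_neg)
  then have dB: "d \<in> span B" using d(1) span_minimal[OF _ subspace_span] by blast
  have term_le: "(d \<bullet> s)\<^sup>2 \<le> (mDW A)\<^sup>2 * (norm d)\<^sup>2" if "s \<in> B" for s
  proof -
    have "s \<in> A" "- s \<in> A" using that assms(6) by auto
    then have "\<bar>d \<bullet> s\<bar> \<le> mDW A * norm d"
      using abs_inner_le_directional_width assms(2) d(2) w by metis
    then have "\<bar>d \<bullet> s\<bar>\<^sup>2 \<le> (mDW A * norm d)\<^sup>2" by (rule power_mono) simp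
    then show ?thesis by (simp add: power_mult_distrib)
  qed
  have "(1 - cumulative_coherence B (n - 1)) * (norm d)\<^sup>2 \<le> (\<Sum>s\<in>B. (d \<bullet> s)\<^sup>2)"
    using sum_abs_inner_le_cumulative_coherence[OF finB] assms(5,8) BA
    by (intro lower_frame_bound[OF finB _ _ dB]) auto
  also have "\<dots> \<le> real n * (mDW A)\<^sup>2 * (norm d)\<^sup>2"
    using sum_bounded_above[of B, OF term_le] assms(8) by (simp add: mult.assoc)
  finally have "1 - cumulative_coherence B (n - 1) \<le> real n * (mDW A)\<^sup>2"
    using d(2) by simp
  then show ?thesis by simp
qed

end
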